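(* Let $r,\nu\in(0,\infty)$ and $p\in(0,1)$. If $r\le 1$, then the $\mathrm{CMNB}(r,\nu,p)$ distribution is discrete infinitely divisible (equivalently, it is a discrete compound Poisson distribution).
   Context: For $r,\nu\in(0,\infty)$ and $p\in(0,1)$, a random variable $X$ follows the COM-negative binomial distribution $\mathrm{CMNB}(r,\nu,p)$ if $$\mathrm{P}(X=k)=\left(\frac{\Gamma(r+k)}{k!\,\Gamma(r)}\right)^{\nu}p^k(1-p)^r\frac{1}{C(r,\nu,p)},\quad k=0,1,2,\ldots,\qquad C(r,\nu,p)=\sum_{i=0}^{\infty}\left(\frac{\Gamma(r+i)}{i!\,\Gamma(r)}\right)^{\nu}p^i(1-p)^r .$$ A non-negative integer valued random variable $X$ with $p_k=\mathrm{P}(X=k)$ is discrete compound Poisson distributed if its probability generating function has the form $$G(z)=\sum_{k=0}^{\infty}p_kz^k=\exp\Big\{\sum_{i=1}^{\infty}\alpha_i\lambda(z^i-1)\Big\},\quad |z|\le 1,$$ where $\sum_{i=1}^{\infty}\alpha_i=1$, $\alpha_i\ge 0$, $\lambda>0$. By Feller's characterization, a non-negative integer valued random variable is discrete infinitely divisible if and only if its distribution is discrete compound Poisson. *)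

theory Defs
  imports "HOL-Probability.Probability" "HOL-Real_Asymp.Real_Asymp"
begin

text \<open>The COM-negative binomial distribution. The positive real \<open>(1 - p)\<close> is raised to the real
  power \<open>r\<close>, hence \<open>powr\<close>.\<close>

definition CMNB_weight :: "real \<Rightarrow> real \<Rightarrow> real \<Rightarrow> nat \<Rightarrow> real" where
  "CMNB_weight r \<nu> p k = (Gamma (r + real k) / (fact k * Gamma r)) powr \<nu> * p ^ k * (1 - p) powr r"

definition CMNB_const :: "real \<Rightarrow> real \<Rightarrow> real \<Rightarrow> real" where
  "CMNB_const r \<nu> p = (\<Sum>i. CMNB_weight r \<nu> p i)"

definition CMNB :: "real \<Rightarrow> real \<Rightarrow> real \<Rightarrow> nat pmf" where
  "CMNB r \<nu> p = embed_pmf (\<lambda>k. CMNB_weight r \<nu> p k / CMNB_const r \<nu> p)"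

text \<open>\<open>embed_pmf\<close> is only meaningful for functions summing to one; \<open>pmf_CMNB\<close> below shows that
  this is the case on the whole parameter range.\<close>

lemma CMNB_weight_pos:
  assumes "r > 0" "0 < p" "p < 1"
  shows "CMNB_weight r \<nu> p k > 0"
proof -
  have "Gamma (r + real k) > 0" "Gamma r > 0"
    using assms by (auto intro!: Gamma_real_pos)
  then have "Gamma (r + real k) / (fact k * Gamma r) > 0"
    by simp
  then have "(Gamma (r + real k) / (fact k * Gamma r)) powr \<nu> > 0"
    by (simp only: powr_gt_zero)
  then show ?thesis
    using assms unfolding CMNB_weight_def by (intro mult_pos_pos) auto
qed

lemma CMNB_weight_Suc:
  assumes "r > 0" "0 < p" "p < 1"
  shows "CMNB_weight r \<nu> p (Suc k) =
    (((r + real k) / (real k + 1)) powr \<nu> * p) * CMNB_weight r \<nu> p k"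
proof -
  have pos: "Gamma (r + real k) > 0" "Gamma r > 0"
    using assms by (auto intro!: Gamma_real_pos)
  have "r + real k \<notin> \<int>\<^sub>\<le>\<^sub>0"
    using assms by (auto dest: nonpos_Ints_nonpos)
  then have "Gamma (r + real k + 1) = (r + real k) * Gamma (r + real k)"
    by (rule Gamma_plus1)
  then have "Gamma (r + real (Suc k)) = (r + real k) * Gamma (r + real k)"
    by (simp add: add_ac)
  then have "Gamma (r + real (Suc k)) / (fact (Suc k) * Gamma r) =
      ((r + real k) / (real k + 1)) * (Gamma (r + real k) / (fact k * Gamma r))"
    by (simp add: add_ac)
  moreover have "(((r + real k) / (real k + 1)) * (Gamma (r + real k) / (fact k * Gamma r))) powr \<nu> =
      ((r + real k) / (real k + 1)) powr \<nu> * (Gamma (r + real k) / (fact k * Gamma r)) powr \<nu>"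
    by (rule powr_mult)
  ultimately show ?thesis
    unfolding CMNB_weight_def by (simp only: power_Suc mult_ac)
qed

lemma summable_CMNB_weight:
  assumes "r > 0" "0 < p" "p < 1"
  shows "summable (CMNB_weight r \<nu> p)"
proof -
  have "(\<lambda>k. (r + real k) / (real k + 1)) \<longlonglongrightarrow> 1"
    by real_asymp
  then have "(\<lambda>k. ((r + real k) / (real k + 1)) powr \<nu> * p) \<longlonglongrightarrow> 1 powr \<nu> * p"
    by (intro tendsto_intros) auto
  then have "\<forall>\<^sub>F k in sequentially. ((r + real k) / (real k + 1)) powr \<nu> * p < (1 + p) / 2"
    using assms by (intro order_tendstoD(2)) auto
  then obtain N where N: "\<And>k. k \<ge> N \<Longrightarrow> ((r + real k) / (real k + 1)) powr \<nu> * p < (1 + p) / 2"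
    by (auto simp: eventually_sequentially)
  show ?thesis
  proof (rule summable_ratio_test)
    show "(1 + p) / 2 < 1"
      using assms by simp
    fix k assume "k \<ge> N"
    then have "((r + real k) / (real k + 1)) powr \<nu> * p * CMNB_weight r \<nu> p k \<le>
        (1 + p) / 2 * CMNB_weight r \<nu> p k"
      using N[of k] CMNB_weight_pos[OF assms, of \<nu> k] by (intro mult_right_mono) auto
    then show "norm (CMNB_weight r \<nu> p (Suc k)) \<le> (1 + p) / 2 * norm (CMNB_weight r \<nu> p k)"
      unfolding CMNB_weight_Suc[OF assms, symmetric] real_norm_def
      by (simp only: abs_of_pos[OF CMNB_weight_pos[OF assms]])
  qed
qed

lemma CMNB_const_pos:
  assumes "r > 0" "0 < p" "p < 1"
  shows "CMNB_const r \<nu> p > 0"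
  unfolding CMNB_const_def
  using summable_CMNB_weight[OF assms] CMNB_weight_pos[OF assms] by (rule suminf_pos)

lemma pmf_CMNB:
  assumes "r > 0" "0 < p" "p < 1"
  shows "pmf (CMNB r \<nu> p) k = CMNB_weight r \<nu> p k / CMNB_const r \<nu> p"
  unfolding CMNB_def
proof (rule pmf_embed_pmf)
  show nonneg: "CMNB_weight r \<nu> p k / CMNB_const r \<nu> p \<ge> 0" for k
    using CMNB_weight_pos[OF assms, of \<nu> k] CMNB_const_pos[OF assms, of \<nu>] by simp
  have "CMNB_weight r \<nu> p sums CMNB_const r \<nu> p"
    unfolding CMNB_const_def using summable_CMNB_weight[OF assms] by (rule summable_sums)
  then have "(\<lambda>k. CMNB_weight r \<nu> p k / CMNB_const r \<nu> p) sums (CMNB_const r \<nu> p / CMNB_const r \<nu> p)"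
    by (rule sums_divide)
  then have "(\<lambda>k. CMNB_weight r \<nu> p k / CMNB_const r \<nu> p) sums 1"
    using CMNB_const_pos[OF assms, of \<nu>] by simp
  then have "(\<Sum>k. ennreal (CMNB_weight r \<nu> p k / CMNB_const r \<nu> p)) = 1"
    using suminf_ennreal_eq[OF nonneg] by simp
  then show "(\<integral>\<^sup>+ k. ennreal (CMNB_weight r \<nu> p k / CMNB_const r \<nu> p) \<partial>count_space UNIV) = 1"
    by (simp add: nn_integral_count_space_nat)
qed

text \<open>The law \<open>X\<close> is, for every \<open>n \<ge> 1\<close>, the law of a sum of \<open>n\<close> independent copies of a
  non-negative integer valued random variable (with law \<open>Y\<close>). The second argument of \<open>Pi_pmf\<close>
  is only the default value outside the index set.\<close>

definition discrete_infinitely_divisible :: "nat pmf \<Rightarrow> bool" where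
  "discrete_infinitely_divisible X \<longleftrightarrow>
    (\<forall>n::nat. n \<ge> 1 \<longrightarrow> (\<exists>Y :: nat pmf. X = map_pmf (\<lambda>f. \<Sum>i<n. f i) (Pi_pmf {..<n} 0 (\<lambda>_. Y))))"

text \<open>Series over \<open>i \<ge> 1\<close> are written with \<open>Suc i\<close>, so \<open>\<alpha> 0\<close> is irrelevant. For
  \<open>norm z \<le> 1\<close> both series in the generating function identity converge absolutely.\<close>

definition discrete_compound_Poisson :: "nat pmf \<Rightarrow> bool" where
  "discrete_compound_Poisson X \<longleftrightarrow>
    (\<exists>(\<alpha> :: nat \<Rightarrow> real) (rate :: real).
       (\<forall>i\<ge>1. \<alpha> i \<ge> 0) \<and> (\<lambda>i. \<alpha> (Suc i)) sums 1 \<and> rate > 0 \<and>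
       (\<forall>z :: complex. norm z \<le> 1 \<longrightarrow>
          (\<Sum>k. of_real (pmf X k) * z ^ k) =
          exp (\<Sum>i. of_real (\<alpha> (Suc i) * rate) * (z ^ Suc i - 1))))"

end

theory Submission imports Defs begin

text \<open>For \<open>r \<le> 1\<close> the ratios \<open>((r + k) / (k + 1)) powr \<nu> * p\<close> of consecutive masses increase in \<open>k\<close>, so the
  masses form a log-convex sequence. The coefficients of the logarithm \<open>A\<close> of the normalised generating
  function are then nonnegative and dominated by \<open>P(X = k) / P(X = 0)\<close>, hence summable. This gives the
  compound Poisson form, and \<open>exp (s A)\<close> with \<open>s = 1 / n\<close>, which is dominated coefficientwise by
  \<open>exp A\<close>, is up to normalisation the generating function of the \<open>n\<close>-th convolution root.\<close>

section \<open>Exponential form of a generating function on the closed unit disc\<close>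

text \<open>The differential equation makes \<open>E * exp (- A)\<close> constant on the open disc.
  Absolutely summable coefficients make both series continuous on the closed disc, so the constant
  persists on the unit circle, in particular at \<open>z = 1\<close>, where total masses are read
  off.\<close>

lemma eval_fps_eq_exp:
  fixes A E :: "'a :: {real_normed_field, banach} fps"
  assumes deriv: "fps_deriv E = fps_deriv A * E" and A0: "fps_nth A 0 = 0"
    and sA: "summable (\<lambda>n. norm (fps_nth A n))" and sE: "summable (\<lambda>n. norm (fps_nth E n))"
    and z: "norm z \<le> 1"
  shows "eval_fps E z = fps_nth E 0 * exp (eval_fps A z)"
proof -
  have radius: "fps_conv_radius f \<ge> 1" if "summable (\<lambda>n. norm (fps_nth f n))" for f :: "'a fps"
    using conv_radius_geI[of "fps_nth f" 1] summable_norm_cancel[OF that]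
    by (simp add: fps_conv_radius_def one_ereal_def)
  have cont: "continuous_on (cball 0 1) (eval_fps f)"
    if f: "summable (\<lambda>n. norm (fps_nth f n))" for f :: "'a fps"
  proof -
    have "norm (fps_nth f n * w ^ n) \<le> norm (fps_nth f n)" if "w \<in> cball 0 1" for n w
      using that by (auto simp: norm_mult norm_power power_le_one mult_left_le)
    from this f have "uniform_limit (cball 0 1) (\<lambda>n w. \<Sum>i<n. fps_nth f i * w ^ i)
        (\<lambda>w. \<Sum>i. fps_nth f i * w ^ i) sequentially"
      by (rule Weierstrass_m_test)
    then show ?thesis
      unfolding eval_fps_def
      by (rule uniform_limit_theorem[rotated])
        (auto intro!: always_eventually continuous_intros)
  qed
  define g where "g w = eval_fps E w * exp (- eval_fps A w)" for w
  have "(g has_field_derivative 0) (at w within ball 0 1)" if w: "w \<in> ball 0 1" for w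
  proof -
    have w': "ereal (norm w) < 1"
      using w by (simp add: one_ereal_def)
    have wA: "ereal (norm w) < fps_conv_radius A" and wE: "ereal (norm w) < fps_conv_radius E"
      using w' radius[OF sA] radius[OF sE] by (meson less_le_trans)+
    have "ereal (norm w) < fps_conv_radius (fps_deriv A)"
      using wA fps_conv_radius_deriv[of A] by (meson less_le_trans)
    then have "eval_fps (fps_deriv E) w = eval_fps (fps_deriv A) w * eval_fps E w"
      unfolding deriv using wE by (rule eval_fps_mult)
    then show ?thesis
      unfolding g_def using wA wE
      by (auto intro!: derivative_eq_intros has_field_derivative_eval_fps)
  qed
  then obtain c where c: "\<And>w. w \<in> ball 0 1 \<Longrightarrow> g w = c"
    using has_field_derivative_zero_constant[OF convex_ball, of 0 1 g] by blast
  have "g z = c"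
  proof (rule continuous_constant_on_closure[where f = g])
    show "continuous_on (closure (ball 0 1)) g"
      unfolding g_def using cont[OF sA] cont[OF sE] by (auto intro!: continuous_intros)
  qed (use c z in auto)
  moreover have "c = fps_nth E 0"
    using c[of 0] A0 by (simp add: g_def eval_fps_at_0)
  ultimately show ?thesis
    by (simp add: g_def exp_minus field_simps)
qed

section \<open>Logarithmic derivative of a log-convex series\<close>

text \<open>Kaluza's argument: the ratios \<open>F (n + 1) / F n\<close> increase, so passing from the convolution identity
  at \<open>n - 1\<close> to the one at \<open>n\<close> multiplies every old term by at most the ratio at \<open>n\<close>.\<close>

lemma fps_log_deriv_bounds:
  fixes F C :: "real fps"
  assumes pos: "\<And>n. fps_nth F n > 0"
    and conv: "\<And>n. (fps_nth F (Suc n))\<^sup>2 \<le> fps_nth F n * fps_nth F (Suc (Suc n))"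
    and deriv: "fps_deriv F = C * F"
  shows "0 < fps_nth C n" and "fps_nth C n * fps_nth F 0 \<le> (real n + 1) * fps_nth F (Suc n)"
proof -
  define t where "t n = fps_nth F (Suc n) / fps_nth F n" for n
  have t: "fps_nth F (Suc n) = t n * fps_nth F n" for n
    using pos[of n] by (simp add: t_def)
  have "t n \<le> t (Suc n)" for n
    using conv[of n] pos[of n] pos[of "Suc n"] by (simp add: t_def field_simps power2_eq_square)
  then have "incseq t"
    by (rule incseq_SucI)
  have rec: "(real n + 1) * fps_nth F (Suc n) = (\<Sum>k\<le>n. fps_nth C k * fps_nth F (n - k))" for n
    using arg_cong[OF deriv, of "\<lambda>f. fps_nth f n"]
    by (simp add: fps_mult_nth atLeast0AtMost add_ac)
  have C_pos: "0 < fps_nth C n" for n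
  proof (induction n rule: less_induct)
    case (less n)
    \<comment> \<open>By \<open>rec\<close>, the gap between the two sides is the single term
      \<open>fps_nth C n * fps_nth F 0\<close>, so strictness here is the positivity claim.\<close>
    have "(\<Sum>k<n. fps_nth C k * fps_nth F (n - k)) < (real n + 1) * fps_nth F (Suc n)"
    proof (cases n)
      case 0
      then show ?thesis using pos by simp
    next
      case (Suc m)
      have "(\<Sum>k<n. fps_nth C k * fps_nth F (n - k)) \<le>
          (\<Sum>k<n. t n * (fps_nth C k * fps_nth F (m - k)))"
      proof (rule sum_mono)
        fix k assume "k \<in> {..<n}"
        then have k: "k < n" "n - k = Suc (m - k)"
          using Suc by auto
        have "t (m - k) \<le> t n"
          using incseqD[OF \<open>incseq t\<close>, of "m - k" n] Suc by simp
        then have "fps_nth F (n - k) \<le> t n * fps_nth F (m - k)"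
          unfolding k t using pos[of "m - k"] by (intro mult_right_mono) auto
        then show "fps_nth C k * fps_nth F (n - k) \<le> t n * (fps_nth C k * fps_nth F (m - k))"
          using mult_left_mono[of _ _ "fps_nth C k"] less[OF k(1)] by (simp add: mult_ac)
      qed
      \<comment> \<open>With \<open>n = Suc m\<close>, the sum is the convolution in
        \<open>rec\<close> at \<open>m\<close>. Strictness then comes from
        \<open>n < n + 1\<close>.\<close>
      also have "\<dots> = t n * (real n * fps_nth F n)"
        using rec[of m] Suc by (simp add: sum_distrib_left lessThan_Suc_atMost add_ac)
      also have "\<dots> = real n * fps_nth F (Suc n)"
        by (simp add: t)
      also have "\<dots> < (real n + 1) * fps_nth F (Suc n)"
        using pos[of "Suc n"] by simp
      finally show ?thesis .
    qed
    then have "0 < fps_nth C n * fps_nth F 0"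
      unfolding rec by (simp add: lessThan_Suc_atMost[symmetric])
    then show ?case
      using pos[of 0] by (simp add: zero_less_mult_iff)
  qed
  show "0 < fps_nth C n"
    by (rule C_pos)
  show "fps_nth C n * fps_nth F 0 \<le> (real n + 1) * fps_nth F (Suc n)"
    unfolding rec
    using member_le_sum[of n "{..n}" "\<lambda>k. fps_nth C k * fps_nth F (n - k)"] C_pos pos
    by (simp add: less_imp_le)
qed

section \<open>Sums of independent variables and products of generating functions\<close>

lemma pmf_add_pair_pmf:
  fixes p q :: "nat pmf"
  shows "pmf (map_pmf (\<lambda>(a, b). a + b) (pair_pmf p q)) n = (\<Sum>i\<le>n. pmf p i * pmf q (n - i))"
proof -
  have shift: "pmf (map_pmf ((+) i) q) n = (if i \<le> n then pmf q (n - i) else 0)" for i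
  proof (cases "i \<le> n")
    case True
    then show ?thesis
      using pmf_map_inj'[of "(+) i" q "n - i"] by simp
  next
    case False
    then have "n \<notin> set_pmf (map_pmf ((+) i) q)"
      by auto
    then show ?thesis
      using False by (simp only: set_pmf_iff) simp
  qed
  have "map_pmf (\<lambda>(a, b). a + b) (pair_pmf p q) = bind_pmf p (\<lambda>i. map_pmf ((+) i) q)"
    by (simp add: pair_pmf_def map_bind_pmf map_pmf_def bind_assoc_pmf bind_return_pmf)
  then have "pmf (map_pmf (\<lambda>(a, b). a + b) (pair_pmf p q)) n =
      measure_pmf.expectation p (\<lambda>i. if i \<le> n then pmf q (n - i) else 0)"
    by (simp add: pmf_bind shift)
  also have "\<dots> = (\<Sum>i\<le>n. (if i \<le> n then pmf q (n - i) else 0) * pmf p i)"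
    by (rule integral_measure_pmf_real) (auto split: if_splits)
  also have "\<dots> = (\<Sum>i\<le>n. pmf p i * pmf q (n - i))"
    by (intro sum.cong) (simp_all add: mult_ac)
  finally show ?thesis .
qed

text \<open>Reduces the search for a convolution root to an \<open>n\<close>-th root of formal power
  series. The induction splits off the coordinate with index \<open>n\<close>, which is independent
  of the others.\<close>

lemma fps_pmf_sum_iid:
  fixes Y :: "nat pmf"
  shows "Abs_fps (pmf (map_pmf (\<lambda>f. \<Sum>i<n. f i) (Pi_pmf {..<n} 0 (\<lambda>_. Y)))) = Abs_fps (pmf Y) ^ n"
proof (induction n)
  case 0
  then show ?case
    by (simp add: fps_eq_iff indicator_def)
next
  case (Suc n)
  let ?P = "Pi_pmf {..<n} 0 (\<lambda>_. Y)"
  have "map_pmf (\<lambda>f. \<Sum>i<Suc n. f i) (Pi_pmf {..<Suc n} 0 (\<lambda>_. Y)) =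
      map_pmf (\<lambda>(a, f). a + (\<Sum>i<n. f i)) (pair_pmf Y ?P)"
    by (simp add: lessThan_Suc Pi_pmf_insert map_pmf_comp case_prod_unfold)
  also have "\<dots> = map_pmf (\<lambda>(a, b). a + b) (pair_pmf Y (map_pmf (\<lambda>f. \<Sum>i<n. f i) ?P))"
    by (simp add: pair_map_pmf2 map_pmf_comp case_prod_unfold)
  finally show ?case
    by (simp add: Suc[symmetric] fps_eq_iff fps_mult_nth pmf_add_pair_pmf atLeast0AtMost)
qed

lemma pmf_sums_1: "pmf (p :: nat pmf) sums 1"
  using sums_integral_count_space_nat[OF integrable_pmf[where M = p and X = UNIV]] integral_pmf[where M = p and X = UNIV]
  by simp

section \<open>The formal logarithm and its exponentials\<close>

text \<open>The chain rule in the form of the differential equation in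
  \<open>eval_fps_eq_exp\<close>, with exponent \<open>fps_const s * A\<close>.\<close>

lemma fps_deriv_exp_compose:
  fixes A :: "real fps"
  assumes "fps_nth A 0 = 0"
  shows "fps_deriv (fps_exp s oo A) = fps_deriv (fps_const s * A) * (fps_exp s oo A)"
  using assms by (simp add: fps_compose_deriv fps_compose_mult_distrib mult_ac)

lemma log_convex_pmf_gf:
  fixes X :: "nat pmf"
  assumes pos: "\<And>n. pmf X n > 0"
    and conv: "\<And>n. (pmf X (Suc n))\<^sup>2 \<le> pmf X n * pmf X (Suc (Suc n))"
  obtains A :: "real fps" where "fps_nth A 0 = 0" "\<And>n. fps_nth A (Suc n) > 0" "summable (fps_nth A)"
    "Abs_fps (pmf X) = fps_const (pmf X 0) * (fps_exp 1 oo A)"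
proof -
  define F where "F = Abs_fps (pmf X)"
  \<comment> \<open>\<open>C\<close> is the logarithmic derivative of \<open>F\<close>. Its
    antiderivative with constant term 0 is the logarithm of \<open>F / F 0\<close>, and can be
    substituted into \<open>fps_exp\<close>.\<close>
  define C where "C = fps_deriv F * inverse F"
  define A where "A = fps_integral0 C"
  have F0: "fps_nth F 0 \<noteq> 0"
    using pos[of 0] by (simp add: F_def)
  have dF: "fps_deriv F = C * F"
    using inverse_mult_eq_1[OF F0] by (simp add: C_def mult.assoc)
  have dA: "fps_deriv A = C"
    by (simp add: A_def fps_deriv_fps_integral)
  have A0: "fps_nth A 0 = 0"
    by (simp add: A_def)
  have AS: "fps_nth A (Suc n) = fps_nth C n / (real n + 1)" for n
    using arg_cong[OF dA, of "\<lambda>f. fps_nth f n"] by (simp add: field_simps)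
  note C = fps_log_deriv_bounds[of F C, OF _ _ dF]
  have Cpos: "fps_nth C n > 0" for n
    by (rule C(1)) (simp_all add: F_def pos conv)
  have Cle: "fps_nth C n * pmf X 0 \<le> (real n + 1) * pmf X (Suc n)" for n
    using C(2)[of n] by (simp add: F_def pos conv)
  have "summable (\<lambda>n. pmf X (Suc n) / pmf X 0)"
    using sums_summable[OF pmf_sums_1[of X]] by (simp add: summable_Suc_iff)
  \<comment> \<open>Integration divides by \<open>n + 1\<close>, which cancels the factor in
    \<open>Cle\<close>.\<close>
  moreover have "norm (fps_nth A (Suc n)) \<le> pmf X (Suc n) / pmf X 0" for n
    using Cle[of n] Cpos[of n] pos[of 0] by (simp add: AS field_simps)
  ultimately have "summable (\<lambda>n. fps_nth A (Suc n))"
    by (rule summable_comparison_test'[where N = 0])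
  then have sA: "summable (fps_nth A)"
    by (simp add: summable_Suc_iff)
  \<comment> \<open>Integrating factor: \<open>F * exp (- A)\<close> is a constant series, and
    multiplying by \<open>exp A\<close> recovers \<open>F\<close>.\<close>
  have "fps_deriv (F * (fps_exp (-1) oo A)) = 0"
    using fps_deriv_exp_compose[OF A0, of "-1"] by (simp add: dF dA algebra_simps flip: fps_const_neg)
  then have "F * (fps_exp (-1) oo A) = fps_const (pmf X 0)"
    by (simp only: fps_deriv_eq_0_iff) (simp add: F_def)
  then have "F * ((fps_exp (-1) oo A) * (fps_exp 1 oo A)) = fps_const (pmf X 0) * (fps_exp 1 oo A)"
    by (simp add: mult.assoc[symmetric])
  moreover have "(fps_exp (-1) oo A) * (fps_exp 1 oo A) = 1"
    using fps_compose_mult_distrib[OF A0, of "fps_exp (-1)" "fps_exp 1"]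
    by (simp add: fps_exp_add_mult[symmetric])
  ultimately have "F = fps_const (pmf X 0) * (fps_exp 1 oo A)"
    by simp
  then show thesis
    using that[of A] A0 sA Cpos by (simp add: AS F_def)
qed

text \<open>In the expansion of \<open>exp (s A)\<close> as the sum of
  \<open>s ^ i * A ^ i / fact i\<close>, every power of \<open>A\<close> has nonnegative
  coefficients and \<open>0 \<le> s ^ i \<le> 1\<close>.\<close>

lemma fps_exp_compose_mono:
  fixes A :: "real fps"
  assumes A0: "fps_nth A 0 = 0" and A: "\<And>n. fps_nth A n \<ge> 0" and s: "0 \<le> s" "s \<le> 1"
  shows "0 \<le> fps_nth (fps_exp s oo A) n" "fps_nth (fps_exp s oo A) n \<le> fps_nth (fps_exp 1 oo A) n"
proof -
  have [simp]: "fps_nth (A ^ i) n \<ge> 0" for i n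
    by (induction i arbitrary: n) (auto simp: fps_mult_nth A fps_one_nth intro!: sum_nonneg)
  have "0 \<le> s ^ i" "s ^ i \<le> 1" for i
    using s by (auto simp: power_le_one)
  then show "0 \<le> fps_nth (fps_exp s oo A) n"
    "fps_nth (fps_exp s oo A) n \<le> fps_nth (fps_exp 1 oo A) n"
    by (auto simp: fps_compose_nth mult_left_le_one_le intro!: sum_nonneg sum_mono divide_right_mono)
qed

section \<open>Convolution roots of a log-convex law\<close>

lemma log_convex_imp_discrete_infinitely_divisible:
  fixes X :: "nat pmf"
  assumes pos: "\<And>n. pmf X n > 0"
    and conv: "\<And>n. (pmf X (Suc n))\<^sup>2 \<le> pmf X n * pmf X (Suc (Suc n))"
  shows "discrete_infinitely_divisible X"
  unfolding discrete_infinitely_divisible_def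
proof (intro allI impI)
  fix n :: nat assume n: "n \<ge> 1"
  obtain A where A0: "fps_nth A 0 = 0" and Apos: "\<And>n. fps_nth A (Suc n) > 0"
    and sA: "summable (fps_nth A)" and X: "Abs_fps (pmf X) = fps_const (pmf X 0) * (fps_exp 1 oo A)"
    using log_convex_pmf_gf[OF pos conv] by blast
  have A_nonneg: "fps_nth A k \<ge> 0" for k
    using A0 Apos by (cases k) (auto intro: less_imp_le)
  define E where "E s = fps_exp s oo A" for s
  have E0: "fps_nth (E s) 0 = 1" for s
    by (simp add: E_def)
  have X': "pmf X k = pmf X 0 * fps_nth (E 1) k" for k
    using arg_cong[OF X, of "\<lambda>f. fps_nth f k"] by (simp add: E_def)
  have E_nonneg: "0 \<le> fps_nth (E s) k" and E_le: "fps_nth (E s) k \<le> fps_nth (E 1) k"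
    if "0 \<le> s" "s \<le> 1" for s k
    using fps_exp_compose_mono[OF A0 A_nonneg that] by (simp_all add: E_def)
  have "fps_nth (E 1) = (\<lambda>k. pmf X k / pmf X 0)"
  proof
    show "fps_nth (E 1) k = pmf X k / pmf X 0" for k
      using X'[of k] pos[of 0] by (simp add: field_simps)
  qed
  then have sE1: "summable (fps_nth (E 1))"
    using sums_summable[OF pmf_sums_1[of X]] by (simp add: summable_divide)
  define L where "L = (\<Sum>k. fps_nth A k)"
  \<comment> \<open>Evaluation at the boundary point 1 gives the total mass of \<open>E s\<close>;
    domination by \<open>E 1\<close> supplies the summability.\<close>
  have E_sums: "fps_nth (E s) sums exp (s * L)" if s: "0 \<le> s" "s \<le> 1" for s
  proof -
    have sE: "summable (fps_nth (E s))"
      using E_nonneg[OF s] E_le[OF s] by (intro summable_comparison_test'[OF sE1, of 0]) simp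
    have "eval_fps (E s) 1 = fps_nth (E s) 0 * exp (eval_fps (fps_const s * A) 1)"
    proof (rule eval_fps_eq_exp)
      show "fps_deriv (E s) = fps_deriv (fps_const s * A) * E s"
        unfolding E_def by (rule fps_deriv_exp_compose[OF A0])
      show "summable (\<lambda>k. norm (fps_nth (fps_const s * A) k))"
        using sA s A_nonneg by (simp add: abs_mult)
      show "summable (\<lambda>k. norm (fps_nth (E s) k))"
        using sE E_nonneg[OF s] by simp
    qed (simp_all add: A0)
    also have "eval_fps (fps_const s * A) 1 = s * L"
      using sA by (simp add: eval_fps_def L_def suminf_mult)
    finally show ?thesis
      using summable_sums[OF sE] by (simp add: eval_fps_def E0)
  qed
  define s where "s = 1 / real n"
  have s: "0 \<le> s" "s \<le> 1" "real n * s = 1"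
    using n by (auto simp: s_def)
  \<comment> \<open>The factor \<open>exp (- s * L)\<close> normalises \<open>E s\<close> to total
    mass 1.\<close>
  define Y where "Y = embed_pmf (\<lambda>k. exp (- s * L) * fps_nth (E s) k)"
  have "pmf Y k = exp (- s * L) * fps_nth (E s) k" for k
    unfolding Y_def
  proof (rule pmf_embed_pmf)
    show nonneg: "0 \<le> exp (- s * L) * fps_nth (E s) k" for k
      using E_nonneg[OF s(1,2)] by simp
    have "(\<lambda>k. exp (- s * L) * fps_nth (E s) k) sums (exp (- s * L) * exp (s * L))"
      using E_sums[OF s(1,2)] by (rule sums_mult)
    then have "(\<lambda>k. exp (- s * L) * fps_nth (E s) k) sums 1"
      by (simp add: exp_minus)
    then have "(\<Sum>k. ennreal (exp (- s * L) * fps_nth (E s) k)) = 1"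
      using suminf_ennreal_eq[OF nonneg] by simp
    then show "(\<integral>\<^sup>+ k. ennreal (exp (- s * L) * fps_nth (E s) k) \<partial>count_space UNIV) = 1"
      by (simp add: nn_integral_count_space_nat)
  qed
  then have Y: "Abs_fps (pmf Y) = fps_const (exp (- s * L)) * E s"
    by (simp add: fps_eq_iff)
  \<comment> \<open>Total mass 1 forces \<open>pmf X 0 = exp (- L)\<close>, which is the
    \<open>n\<close>-th power of the normalising factor of \<open>Y\<close>.\<close>
  have "pmf X sums (pmf X 0 * exp L)"
    using sums_mult[OF E_sums[of 1], of "pmf X 0"] by (simp add: X'[symmetric])
  then have "pmf X 0 * exp L = 1"
    using pmf_sums_1 sums_unique2 by blast
  then have X0: "pmf X 0 = exp (- L)"
    by (simp add: exp_minus field_simps)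
  have "E s ^ n = (fps_exp s ^ n) oo A"
    unfolding E_def using A0 by (rule fps_compose_power)
  also have "\<dots> = E 1"
    using s(3) by (simp add: E_def fps_exp_power_mult)
  finally have "Abs_fps (pmf Y) ^ n = fps_const (exp (- s * L) ^ n) * E 1"
    by (simp add: Y power_mult_distrib fps_const_power)
  also have "exp (- s * L) ^ n = exp (- L)"
    using s(3) by (simp add: exp_of_nat_mult[symmetric] mult.assoc[symmetric])
  finally have "Abs_fps (pmf X) = Abs_fps (pmf Y) ^ n"
    using X by (simp add: X0 E_def)
  then have "X = map_pmf (\<lambda>f. \<Sum>i<n. f i) (Pi_pmf {..<n} 0 (\<lambda>_. Y))"
    unfolding fps_pmf_sum_iid[symmetric] by (intro pmf_eqI) (simp add: fps_eq_iff)
  then show "\<exists>Y. X = map_pmf (\<lambda>f. \<Sum>i<n. f i) (Pi_pmf {..<n} 0 (\<lambda>_. Y))" ..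
qed

section \<open>The compound Poisson form of a log-convex law\<close>

text \<open>The generating function is \<open>exp (A(z) - A(1))\<close>. Hence the rate is
  \<open>L = A(1)\<close> and the jump law has masses \<open>A k / L\<close>.\<close>

lemma log_convex_imp_discrete_compound_Poisson:
  fixes X :: "nat pmf"
  assumes pos: "\<And>n. pmf X n > 0"
    and conv: "\<And>n. (pmf X (Suc n))\<^sup>2 \<le> pmf X n * pmf X (Suc (Suc n))"
  shows "discrete_compound_Poisson X"
proof -
  obtain A where A0: "fps_nth A 0 = 0" and Apos: "\<And>n. fps_nth A (Suc n) > 0"
    and sA: "summable (fps_nth A)" and X: "Abs_fps (pmf X) = fps_const (pmf X 0) * (fps_exp 1 oo A)"
    using log_convex_pmf_gf[OF pos conv] by blast
  have A_nonneg: "fps_nth A k \<ge> 0" for k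
    using A0 Apos by (cases k) (auto intro: less_imp_le)
  have dX: "fps_deriv (Abs_fps (pmf X)) = fps_deriv A * Abs_fps (pmf X)"
    using fps_deriv_exp_compose[OF A0, of 1] unfolding X by (simp add: mult_ac)
  define cA :: "complex fps" where "cA = Abs_fps (\<lambda>k. of_real (fps_nth A k))"
  define cX :: "complex fps" where "cX = Abs_fps (\<lambda>k. of_real (pmf X k))"
  have gf: "eval_fps cX z = pmf X 0 * exp (eval_fps cA z)" if "norm z \<le> 1" for z
  proof -
    \<comment> \<open>The real differential equation carries over to complex series coefficient by
      coefficient.\<close>
    have "fps_deriv cX = fps_deriv cA * cX"
    proof (rule fps_ext)
      fix k
      show "fps_nth (fps_deriv cX) k = fps_nth (fps_deriv cA * cX) k"
        using arg_cong[OF dX, of "\<lambda>f. complex_of_real (fps_nth f k)"]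
        by (simp add: cX_def cA_def fps_mult_nth)
    qed
    moreover have "summable (\<lambda>k. norm (fps_nth cA k))" "summable (\<lambda>k. norm (fps_nth cX k))"
      using sA sums_summable[OF pmf_sums_1[of X]] A_nonneg by (simp_all add: cA_def cX_def)
    ultimately have "eval_fps cX z = fps_nth cX 0 * exp (eval_fps cA z)"
      using that by (intro eval_fps_eq_exp) (simp_all add: cA_def A0)
    then show ?thesis
      by (simp add: cX_def)
  qed
  define L where "L = (\<Sum>k. fps_nth A (Suc k))"
  have sAS: "summable (\<lambda>k. fps_nth A (Suc k))"
    using sA by (simp add: summable_Suc_iff)
  have L: "(\<lambda>k. fps_nth A (Suc k)) sums L"
    unfolding L_def using sAS by (rule summable_sums)
  have L_pos: "L > 0"
    unfolding L_def using sAS Apos by (rule suminf_pos)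
  have cA_sums: "(\<lambda>k. of_real (fps_nth A (Suc k)) * z ^ Suc k) sums eval_fps cA z"
    if "norm z \<le> 1" for z :: complex
  proof -
    have "norm (of_real (fps_nth A k) * z ^ k) \<le> fps_nth A k" for k
      using that A_nonneg[of k] by (auto simp: norm_mult norm_power power_le_one mult_left_le)
    then have "summable (\<lambda>k. of_real (fps_nth A k) * z ^ k)"
      by (intro summable_comparison_test'[OF sA, of 0])
    then have "(\<lambda>k. of_real (fps_nth A k) * z ^ k) sums eval_fps cA z"
      unfolding eval_fps_def cA_def by (simp add: summable_sums)
    \<comment> \<open>The term at index 0 vanishes, so the sum may start at index 1.\<close>
    then show ?thesis
      by (subst sums_Suc_iff) (simp add: A0)
  qed
  have cL: "(\<lambda>k. complex_of_real (fps_nth A (Suc k))) sums of_real L"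
    using L by (rule sums_of_real)
  have "eval_fps cA 1 = of_real L"
    using cA_sums[of 1] cL sums_unique2 by fastforce
  moreover have "eval_fps cX 1 = 1"
    using sums_of_real[OF pmf_sums_1[of X], where 'a = complex]
    by (simp add: eval_fps_def cX_def sums_iff)
  ultimately have "pmf X 0 * exp (complex_of_real L) = 1"
    using gf[of 1] by simp
  then have X0: "complex_of_real (pmf X 0) = exp (- of_real L)"
    by (simp add: exp_minus field_simps)
  show ?thesis
    unfolding discrete_compound_Poisson_def
  proof (intro exI[of _ "\<lambda>k. fps_nth A k / L"] exI[of _ L] conjI allI impI)
    show "(\<lambda>k. fps_nth A (Suc k) / L) sums 1"
      using sums_divide[OF L, of L] L_pos by simp
  next
    fix z :: complex assume z: "norm z \<le> 1"
    have "(\<lambda>k. of_real (fps_nth A (Suc k)) * z ^ Suc k - of_real (fps_nth A (Suc k)))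
        sums (eval_fps cA z - of_real L)"
      using cA_sums[OF z] cL by (rule sums_diff)
    then have "(\<Sum>k. of_real (fps_nth A (Suc k) / L * L) * (z ^ Suc k - 1)) = eval_fps cA z - of_real L"
      using L_pos by (simp only: sums_iff nonzero_divide_eq_eq) (simp add: right_diff_distrib)
    moreover have "(\<Sum>k. of_real (pmf X k) * z ^ k) = eval_fps cX z"
      by (simp add: eval_fps_def cX_def)
    ultimately show "(\<Sum>k. of_real (pmf X k) * z ^ k) =
        exp (\<Sum>k. of_real (fps_nth A (Suc k) / L * L) * (z ^ Suc k - 1))"
      by (simp only: gf[OF z] X0) (simp add: exp_diff exp_minus divide_inverse mult.commute)
  qed (use A_nonneg L_pos in auto)
qed

section \<open>Log-convexity of the COM-negative binomial masses\<close>

lemma CMNB_log_convex: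
  fixes r \<nu> p :: real
  assumes "0 < r" "r \<le> 1" "0 \<le> \<nu>" "0 < p" "p < 1"
  shows "(pmf (CMNB r \<nu> p) (Suc n))\<^sup>2 \<le> pmf (CMNB r \<nu> p) n * pmf (CMNB r \<nu> p) (Suc (Suc n))"
proof -
  define w where "w = CMNB_weight r \<nu> p"
  define t where "t k = ((r + real k) / (real k + 1)) powr \<nu> * p" for k
  have w_pos: "w k > 0" for k
    unfolding w_def using assms by (intro CMNB_weight_pos)
  have w_Suc: "w (Suc k) = t k * w k" for k
    unfolding w_def t_def using assms by (intro CMNB_weight_Suc)
  \<comment> \<open>Here \<open>r \<le> 1\<close> enters: after cross-multiplication the inequality
    is exactly this condition.\<close>
  have "(r + real n) / (real n + 1) \<le> (r + real (Suc n)) / (real (Suc n) + 1)"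
    using assms by (simp add: field_simps)
  then have "t n \<le> t (Suc n)"
    unfolding t_def using assms by (intro mult_right_mono powr_mono2) auto
  \<comment> \<open>By \<open>w_Suc\<close>, the left side is \<open>(w (Suc n))^2\<close> and the
    right side is \<open>w n * w (Suc (Suc n))\<close>.\<close>
  then have "w n * w (Suc n) * t n \<le> w n * w (Suc n) * t (Suc n)"
    using w_pos by (intro mult_left_mono) (auto intro: less_imp_le)
  then have "(w (Suc n))\<^sup>2 \<le> w n * w (Suc (Suc n))"
    unfolding w_Suc[of "Suc n"] by (simp add: w_Suc[of n] power2_eq_square mult_ac)
  \<comment> \<open>Both sides are quadratic in the masses, so normalisation divides each by the
    same squared constant.\<close>
  then show ?thesis
    using assms
    by (simp add: pmf_CMNB w_def power_divide power2_eq_square divide_right_mono)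
qed

theorem corollary2p1:
  fixes r \<nu> p :: real
  assumes "0 < r" and "0 < \<nu>" and "0 < p" and "p < 1" and "r \<le> 1"
  shows "discrete_infinitely_divisible (CMNB r \<nu> p) \<and> discrete_compound_Poisson (CMNB r \<nu> p)"
proof -
  have "pmf (CMNB r \<nu> p) n > 0" for n
    using assms by (simp add: pmf_CMNB CMNB_weight_pos CMNB_const_pos)
  moreover have "(pmf (CMNB r \<nu> p) (Suc n))\<^sup>2 \<le> pmf (CMNB r \<nu> p) n * pmf (CMNB r \<nu> p) (Suc (Suc n))" for n
    using assms by (intro CMNB_log_convex) auto
  ultimately show ?thesis
    using log_convex_imp_discrete_infinitely_divisible log_convex_imp_discrete_compound_Poisson by blast
qed

end
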